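(* For every integer $n \geq 12$, $\mathcal{T}(n) \leq 1.09 \cdot \left(\frac{3}{2}\right)^n$.
   Context: A code $\mathcal{C} \subseteq \{0,1,2\}^n$ is called trifferent with length $n$ if for any three distinct elements of $\mathcal{C}$ there exists a coordinate in which they all differ. $\mathcal{T}(n)$ denotes the maximum cardinality of a trifferent code with length $n$. *)

theory Defs
  imports Complex_Main
begin

definition ternary_words :: "nat \<Rightarrow> nat list set" where
  "ternary_words n = {w. length w = n \<and> set w \<subseteq> {0, 1, 2}}"

definition trifferent :: "nat \<Rightarrow> nat list set \<Rightarrow> bool" where
  "trifferent n C \<longleftrightarrow> C \<subseteq> ternary_words n \<and>
     (\<forall>x\<in>C. \<forall>y\<in>C. \<forall>z\<in>C. x \<noteq> y \<and> y \<noteq> z \<and> x \<noteq> z \<longrightarrow>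
        (\<exists>i<n. x ! i \<noteq> y ! i \<and> y ! i \<noteq> z ! i \<and> x ! i \<noteq> z ! i))"

definition max_trifferent :: "nat \<Rightarrow> nat" where
  "max_trifferent n = Max (card ` {C. trifferent n C})"

text \<open>The maximum ranges over a finite nonempty set, so it is attained, and every
  trifferent code is finite, so \<^const>\<open>card\<close> is its true cardinality.\<close>

lemma finite_ternary_words: "finite (ternary_words n)"
proof -
  have "ternary_words n = {w. set w \<subseteq> {0, 1, 2} \<and> length w = n}"
    by (auto simp: ternary_words_def)
  then show ?thesis
    using finite_lists_length_eq[of "{0, 1, 2 :: nat}" n] by simp
qed

lemma trifferent_finite: "trifferent n C \<Longrightarrow> finite C"
  using finite_ternary_words finite_subset unfolding trifferent_def by blast

lemma finite_trifferent_codes: "finite {C. trifferent n C}"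
  by (rule finite_subset[of _ "Pow (ternary_words n)"])
     (auto simp: trifferent_def finite_ternary_words)

lemma trifferent_empty: "trifferent n {}"
  by (simp add: trifferent_def)

lemma max_trifferent_attained: "\<exists>C. trifferent n C \<and> card C = max_trifferent n"
proof -
  have "Max (card ` {C. trifferent n C}) \<in> card ` {C. trifferent n C}"
    by (rule Max_in) (use finite_trifferent_codes trifferent_empty in auto)
  then show ?thesis
    unfolding max_trifferent_def by auto
qed

lemma card_le_max_trifferent: "trifferent n C \<Longrightarrow> card C \<le> max_trifferent n"
  unfolding max_trifferent_def using finite_trifferent_codes by (intro Max_ge) auto

end

theory Submission
  imports Defs
begin

text \<open>Deleting from a trifferent code of length \<open>n + 1\<close> the words that carry the sparsest symbol of some
  coordinate leaves at least two thirds of the words, and dropping that coordinate turns them into a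
  trifferent code of length \<open>n\<close>. Hence the maximal size grows at most by a factor \<open>3 / 2\<close>, rounded
  down, per coordinate, and the bound follows from \<open>T(6) \<le> 13\<close> along the chain
  13, 19, 28, 42, 63, 94, 141 up to length 12.

  Read backwards, the same deletion sends a code of length 6 with 14 words to codes of lengths
  5, 4, 3, 2, 1 with at least 10, 7, 5, 4, 3 words. Up to permutations of the coordinates and of the
  symbols in each coordinate there are only 5, 6, 3, 1, 1 such codes. They are classified by going up:
  a code of length \<open>n + 1\<close> is a classified code \<open>K\<close> of length \<open>n\<close> with heads 0 and 1 attached,
  together with words of head 2, and a word of head 2 forces different heads on each pair of words of
  \<open>K\<close> from which it is not separated by its tail. This leaves few extensions, and none of size 14
  in length 6.\<close>

section \<open>Separated triples and symmetries\<close>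

text \<open>Recursive form of the trifference condition: it can be evaluated by rewriting and lets
  the first coordinate be split off. Words of unequal length are compared only up to the shortest
  one.\<close>

fun separated :: "nat list \<Rightarrow> nat list \<Rightarrow> nat list \<Rightarrow> bool" where
  "separated (a # x) (b # y) (c # z) \<longleftrightarrow> (a \<noteq> b \<and> b \<noteq> c \<and> a \<noteq> c) \<or> separated x y z"
| "separated _ _ _ \<longleftrightarrow> False"

lemma separated_iff_nth:
  assumes "length x = n" "length y = n" "length z = n"
  shows "separated x y z \<longleftrightarrow> (\<exists>i<n. x ! i \<noteq> y ! i \<and> y ! i \<noteq> z ! i \<and> x ! i \<noteq> z ! i)"
  using assms
proof (induction n arbitrary: x y z)
  case 0
  then show ?case by simp
next
  case (Suc n)
  then obtain a x' b y' c z' where "x = a # x'" "y = b # y'" "z = c # z'"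
    "length x' = n" "length y' = n" "length z' = n"
    by (metis length_Suc_conv)
  then show ?case
    using Suc.IH[of x' y' z'] by (simp add: Ex_less_Suc2)
qed

lemma Cons_in_ternary_words [simp]:
  "a # x \<in> ternary_words (Suc n) \<longleftrightarrow> a \<in> {0, 1, 2} \<and> x \<in> ternary_words n"
  by (auto simp: ternary_words_def)

lemma ternary_words_SucE:
  assumes "x \<in> ternary_words (Suc n)"
  obtains a v where "x = a # v" "a \<in> {0, 1, 2}" "v \<in> ternary_words n"
  using assms by (cases x) (auto simp: ternary_words_def)

lemma ternary_words_SucD:
  assumes "x \<in> ternary_words (Suc n)"
  shows "hd x \<in> {0, 1, 2}" "tl x \<in> ternary_words n" "hd x # tl x = x"
  using assms by (auto elim: ternary_words_SucE)

lemma trifferent_iff_separated: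
  "trifferent n C \<longleftrightarrow> C \<subseteq> ternary_words n \<and>
     (\<forall>x\<in>C. \<forall>y\<in>C. \<forall>z\<in>C. x \<noteq> y \<and> y \<noteq> z \<and> x \<noteq> z \<longrightarrow> separated x y z)"
proof -
  have "separated x y z \<longleftrightarrow> (\<exists>i<n. x ! i \<noteq> y ! i \<and> y ! i \<noteq> z ! i \<and> x ! i \<noteq> z ! i)"
    if "C \<subseteq> ternary_words n" "x \<in> C" "y \<in> C" "z \<in> C" for x y z
    using that by (intro separated_iff_nth) (auto simp: ternary_words_def)
  then show ?thesis
    unfolding trifferent_def by blast
qed

lemma trifferent_separated:
  assumes "trifferent n C" "x \<in> C" "y \<in> C" "z \<in> C" "x \<noteq> y" "y \<noteq> z" "x \<noteq> z"
  shows "separated x y z"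
  using assms unfolding trifferent_iff_separated by blast

section \<open>Symmetries of the space of words\<close>

text \<open>Injectivity and one-way preservation of separation suffice to carry a trifferent code to
  a trifferent code of the same size.\<close>

definition symmetry :: "nat \<Rightarrow> (nat list \<Rightarrow> nat list) \<Rightarrow> bool" where
  "symmetry n g \<longleftrightarrow> g ` ternary_words n \<subseteq> ternary_words n \<and> inj_on g (ternary_words n) \<and>
     (\<forall>x\<in>ternary_words n. \<forall>y\<in>ternary_words n. \<forall>z\<in>ternary_words n.
        separated x y z \<longrightarrow> separated (g x) (g y) (g z))"

lemma symmetry_id: "symmetry n id"
  by (simp add: symmetry_def)

lemma symmetry_comp:
  assumes "symmetry n g" "symmetry n h"
  shows "symmetry n (g \<circ> h)"
proof -
  have *: "h x \<in> ternary_words n" if "x \<in> ternary_words n" for x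
    using assms(2) that by (auto simp: symmetry_def)
  have "inj_on (g \<circ> h) (ternary_words n)"
    using assms by (intro comp_inj_on) (auto simp: symmetry_def intro: inj_on_subset)
  then show ?thesis
    using assms * by (auto simp: symmetry_def)
qed

lemma symmetry_card:
  assumes "symmetry n g" "C \<subseteq> ternary_words n"
  shows "card (g ` C) = card C"
  using assms by (intro card_image) (auto simp: symmetry_def intro: inj_on_subset)

lemma symmetry_trifferent:
  assumes "symmetry n g" "trifferent n C"
  shows "trifferent n (g ` C)"
  unfolding trifferent_iff_separated
proof (intro conjI ballI impI)
  have words: "C \<subseteq> ternary_words n"
    using assms(2) by (simp add: trifferent_def)
  then show "g ` C \<subseteq> ternary_words n"
    using assms(1) by (auto simp: symmetry_def)
  fix x y z assume "x \<in> g ` C" "y \<in> g ` C" "z \<in> g ` C" and neq: "x \<noteq> y \<and> y \<noteq> z \<and> x \<noteq> z"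
  then obtain u v w where uvw: "u \<in> C" "v \<in> C" "w \<in> C" and eqs: "x = g u" "y = g v" "z = g w"
    by blast
  have "separated u v w"
    using uvw eqs neq by (intro trifferent_separated[OF assms(2)]) auto
  moreover have "u \<in> ternary_words n" "v \<in> ternary_words n" "w \<in> ternary_words n"
    using uvw words by auto
  ultimately show "separated x y z"
    using assms(1) by (simp add: symmetry_def eqs)
qed

text \<open>A triple separated by its heads stays so because \<open>\<sigma>\<close> is injective,
  one separated by its tails because \<open>g\<close> is a symmetry.\<close>

lemma symmetry_Cons:
  assumes "inj_on \<sigma> {0, 1, 2}" "\<sigma> ` {0, 1, 2} \<subseteq> {0, 1, 2}" "symmetry n g"
  shows "symmetry (Suc n) (\<lambda>x. \<sigma> (hd x) # g (tl x))"
proof -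
  have inj: "\<sigma> a = \<sigma> b \<longleftrightarrow> a = b" if "a \<in> {0, 1, 2}" "b \<in> {0, 1, 2}" for a b
    using assms(1) that by (rule inj_on_eq_iff)
  have "separated (\<sigma> (hd x) # g (tl x)) (\<sigma> (hd y) # g (tl y)) (\<sigma> (hd z) # g (tl z))"
    if "x \<in> ternary_words (Suc n)" "y \<in> ternary_words (Suc n)" "z \<in> ternary_words (Suc n)"
      "separated x y z" for x y z
    using that assms(3) inj
    by (elim ternary_words_SucE) (simp add: symmetry_def, blast)
  moreover have "\<sigma> (hd x) # g (tl x) \<in> ternary_words (Suc n)"
    if "x \<in> ternary_words (Suc n)" for x
    using that assms(2,3) by (elim ternary_words_SucE) (auto simp: symmetry_def)
  moreover have "inj_on (\<lambda>x. \<sigma> (hd x) # g (tl x)) (ternary_words (Suc n))"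
  proof (rule inj_onI)
    fix x y assume "x \<in> ternary_words (Suc n)" "y \<in> ternary_words (Suc n)"
      "\<sigma> (hd x) # g (tl x) = \<sigma> (hd y) # g (tl y)"
    moreover from this have "hd x = hd y"
      using inj ternary_words_SucD(1) by blast
    moreover from calculation have "tl x = tl y"
      using assms(3) by (auto simp: symmetry_def dest: inj_onD ternary_words_SucD)
    ultimately show "x = y"
      by (metis ternary_words_SucD(3))
  qed
  ultimately show ?thesis
    unfolding symmetry_def by blast
qed

text \<open>A pair \<open>(i, s)\<close> at position \<open>j\<close> says that the new coordinate \<open>j\<close> is the old coordinate \<open>i\<close>
  with its symbols permuted by the \<open>s\<close>-th permutation below.\<close>

definition symbol_perms :: "nat list list" where
  "symbol_perms = [[0, 1, 2], [0, 2, 1], [1, 0, 2], [1, 2, 0], [2, 0, 1], [2, 1, 0]]"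

definition relabel :: "(nat \<times> nat) list \<Rightarrow> nat list \<Rightarrow> nat list" where
  "relabel g x = map (\<lambda>(i, s). symbol_perms ! s ! (x ! i)) g"

text \<open>A list of length \<open>n\<close> that hits all \<open>n\<close> coordinates hits each
  exactly once. The last quantifier ranges over a list so that the check can be evaluated.\<close>

definition valid_relabelling :: "nat \<Rightarrow> (nat \<times> nat) list \<Rightarrow> bool" where
  "valid_relabelling n g \<longleftrightarrow> length g = n \<and> (\<forall>(i, s)\<in>set g. i < n \<and> s < 6) \<and>
     (\<forall>i\<in>set [0..<n]. i \<in> set (map fst g))"

lemma symbol_perms_inj:
  assumes "s < 6" "a \<in> {0, 1, 2}" "b \<in> {0, 1, 2}"
  shows "symbol_perms ! s ! a = symbol_perms ! s ! b \<longleftrightarrow> a = b"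
proof -
  have "s \<in> {0, 1, 2, 3, 4, 5}"
    using assms(1) by auto
  then show ?thesis
    using assms(2,3) by (auto simp: symbol_perms_def)
qed

lemma symbol_perms_range:
  assumes "s < 6" "a \<in> {0, 1, 2}"
  shows "symbol_perms ! s ! a \<in> {0, 1, 2}"
proof -
  have "s \<in> {0, 1, 2, 3, 4, 5}"
    using assms(1) by auto
  then show ?thesis
    using assms(2) by (auto simp: symbol_perms_def)
qed

text \<open>Every old coordinate \<open>i\<close> reappears at some new position \<open>j\<close>
  with its symbols permuted injectively, so whether words differ at \<open>i\<close> can be read off
  at \<open>j\<close>.\<close>

lemma symmetry_relabel:
  assumes "valid_relabelling n g"
  shows "symmetry n (relabel g)"
proof -
  have cover: "\<exists>s. (i, s) \<in> set g" if "i < n" for i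
    using assms that by (fastforce simp: valid_relabelling_def)
  have bounds: "i < n \<and> s < 6" if "(i, s) \<in> set g" for i s
    using assms that by (auto simp: valid_relabelling_def)
  have len: "length g = n"
    using assms by (simp add: valid_relabelling_def)
  have nth: "x ! i \<in> {0, 1, 2}" if "x \<in> ternary_words n" "i < n" for x i
    using that nth_mem[of i x] unfolding ternary_words_def by blast
  have cover': "\<exists>j<n. \<exists>s<6. g ! j = (i, s)" if "i < n" for i
    using cover[OF that] bounds len by (metis in_set_conv_nth)
  have words: "relabel g x \<in> ternary_words n" if "x \<in> ternary_words n" for x
  proof -
    have "symbol_perms ! s ! (x ! i) \<in> {0, 1, 2}" if "(i, s) \<in> set g" for i s
      using bounds[OF that] nth[OF \<open>x \<in> ternary_words n\<close>] by (intro symbol_perms_range) auto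
    then show ?thesis
      using len unfolding ternary_words_def relabel_def by force
  qed
  have val: "relabel g x ! j = symbol_perms ! s ! (x ! i)" if "j < n" "g ! j = (i, s)" for x i j s
    using that len by (simp add: relabel_def)
  have "x = y" if "x \<in> ternary_words n" "y \<in> ternary_words n" "relabel g x = relabel g y" for x y
  proof (rule nth_equalityI)
    show "length x = length y"
      using that by (simp add: ternary_words_def)
    fix i assume "i < length x"
    then have i: "i < n"
      using that by (simp add: ternary_words_def)
    then obtain j s where "j < n" "s < 6" "g ! j = (i, s)"
      using cover' by blast
    then show "x ! i = y ! i"
      using that(3) val symbol_perms_inj[of s "x ! i" "y ! i"] nth that(1,2) i by metis
  qed
  moreover have "separated (relabel g x) (relabel g y) (relabel g z)"
    if xyz: "x \<in> ternary_words n" "y \<in> ternary_words n" "z \<in> ternary_words n"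
      and sep: "separated x y z" for x y z
  proof -
    have "length x = n" "length y = n" "length z = n"
      using xyz by (auto simp: ternary_words_def)
    then obtain i where i: "i < n" "x ! i \<noteq> y ! i" "y ! i \<noteq> z ! i" "x ! i \<noteq> z ! i"
      using sep by (auto simp: separated_iff_nth)
    obtain j s where j: "j < n" "s < 6" "g ! j = (i, s)"
      using cover' i by blast
    have "\<exists>j<n. relabel g x ! j \<noteq> relabel g y ! j \<and> relabel g y ! j \<noteq> relabel g z ! j \<and>
        relabel g x ! j \<noteq> relabel g z ! j"
      using i j nth xyz by (intro exI[of _ j]) (simp only: val symbol_perms_inj, simp)
    moreover have "length (relabel g w) = n" for w
      using len by (simp add: relabel_def)
    ultimately show ?thesis
      by (subst separated_iff_nth) auto
  qed
  ultimately show ?thesis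
    using words unfolding symmetry_def by (auto intro: inj_onI)
qed

section \<open>Deleting the sparsest symbol of a coordinate\<close>

text \<open>With only two symbols left as heads, no triple is separated by the first coordinate, so
  the tails must separate it. Two words with equal tails could then not be separated from a third
  word.\<close>

lemma tails_of_two_symbols:
  assumes C: "trifferent (Suc n) C" and card: "3 \<le> card {x \<in> C. hd x \<noteq> s}" and s: "s \<in> {0, 1, 2}"
  shows "inj_on tl {x \<in> C. hd x \<noteq> s}" and "trifferent n (tl ` {x \<in> C. hd x \<noteq> s})"
proof -
  let ?A = "{x \<in> C. hd x \<noteq> s}"
  have words: "C \<subseteq> ternary_words (Suc n)"
    using C by (simp add: trifferent_def)
  have sep: "separated (tl x) (tl y) (tl z)"
    if "x \<in> ?A" "y \<in> ?A" "z \<in> ?A" "x \<noteq> y" "y \<noteq> z" "x \<noteq> z" for x y z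
  proof -
    have words3: "x \<in> ternary_words (Suc n)" "y \<in> ternary_words (Suc n)" "z \<in> ternary_words (Suc n)"
      using that words by auto
    have "separated x y z"
      using that C by (intro trifferent_separated[of "Suc n" C]) auto
    then have "separated (hd x # tl x) (hd y # tl y) (hd z # tl z)"
      using words3 by (simp add: ternary_words_SucD(3))
    moreover have "hd x \<noteq> s" "hd y \<noteq> s" "hd z \<noteq> s"
      using that by auto
    ultimately show ?thesis
      using words3[THEN ternary_words_SucD(1)] s by auto
  qed
  have irrefl: "\<not> separated u u v" for u v
  proof (induction u arbitrary: v)
    case (Cons a u)
    then show ?case by (cases v) auto
  qed simp
  show "inj_on tl ?A"
  proof (rule inj_onI)
    fix x y assume xy: "x \<in> ?A" "y \<in> ?A" "tl x = tl y"
    \<comment> \<open>This is where three words are needed: they supply a third word to test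
      \<open>x\<close> and \<open>y\<close> against.\<close>
    have "\<not> ?A \<subseteq> {x, y}"
      using card card_mono[of "{x, y}" ?A] card_insert_le_m1[of 2 "{y}" x] by auto
    then obtain z where "z \<in> ?A" "z \<noteq> x" "z \<noteq> y"
      by blast
    then show "x = y"
      using sep[of x y z] xy irrefl by metis
  qed
  have "tl ` ?A \<subseteq> ternary_words n"
    using words ternary_words_SucD(2) by blast
  then show "trifferent n (tl ` ?A)"
    using sep unfolding trifferent_iff_separated by blast
qed

text \<open>Pigeonhole: one of the three symbols heads at most a third of the words.\<close>

lemma sparsest_symbol:
  assumes "trifferent (Suc n) C"
  obtains s where "s \<in> {0, 1, 2}" "2 * card C \<le> 3 * card {x \<in> C. hd x \<noteq> s}"
proof -
  have fin: "finite C"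
    using assms by (rule trifferent_finite)
  have split: "card C = card {x \<in> C. hd x = s} + card {x \<in> C. hd x \<noteq> s}" for s
    using fin by (subst card_Un_disjoint[symmetric]) (auto intro: arg_cong[where f = card])
  have "C = {x \<in> C. hd x = 0} \<union> {x \<in> C. hd x = 1} \<union> {x \<in> C. hd x = 2}"
    using assms ternary_words_SucD(1) unfolding trifferent_def by blast
  then have "card C \<le> card {x \<in> C. hd x = 0} + card {x \<in> C. hd x = 1} + card {x \<in> C. hd x = 2}"
    by (metis (no_types, lifting) card_Un_le add_le_mono1 order_trans)
  moreover have "card {x \<in> C. hd x = 0} + card {x \<in> C. hd x = 1} + card {x \<in> C. hd x = 2} \<le> card C"
    using fin by (subst card_Un_disjoint[symmetric], auto)+ (auto intro!: card_mono)
  ultimately have "\<exists>s\<in>{0, 1, 2}. 3 * card {x \<in> C. hd x = s} \<le> card C"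
    by auto
  then obtain s where s: "s \<in> {0, 1, 2}" "3 * card {x \<in> C. hd x = s} \<le> card C"
    by blast
  then have "2 * card C \<le> 3 * card {x \<in> C. hd x \<noteq> s}"
    using split[of s] by simp
  with s(1) show ?thesis
    by (rule that)
qed

lemma code_size_recursion:
  assumes bound: "\<And>D. trifferent n D \<Longrightarrow> card D \<le> M" and "2 \<le> M" and C: "trifferent (Suc n) C"
  shows "2 * card C \<le> 3 * M"
\<comment> \<open>Up to three words the claim is just \<open>2 \<le> M\<close>; from four words on,
  at least three survive the deletion, as the lemma on tails demands.\<close>
proof (cases "card C \<le> 3")
  case True
  then show ?thesis using \<open>2 \<le> M\<close> by simp
next
  case False
  obtain s where s: "s \<in> {0, 1, 2}" "2 * card C \<le> 3 * card {x \<in> C. hd x \<noteq> s}"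
    using sparsest_symbol[OF C] .
  then have "3 \<le> card {x \<in> C. hd x \<noteq> s}"
    using False by simp
  note tails_of_two_symbols[OF C this s(1)]
  then have "card {x \<in> C. hd x \<noteq> s} \<le> M"
    using bound by (metis (no_types, lifting) card_image)
  then show ?thesis using s by simp
qed

section \<open>Extending a classification by one coordinate\<close>

text \<open>Only completeness of the list is claimed. In particular, \<open>L = []\<close> says that
  no trifferent code of length \<open>n\<close> has \<open>m\<close> words.\<close>

definition classified :: "nat \<Rightarrow> nat \<Rightarrow> nat list list list \<Rightarrow> bool" where
  "classified n m L \<longleftrightarrow> (\<forall>C. trifferent n C \<longrightarrow> m \<le> card C \<longrightarrow>
     (\<exists>g. symmetry n g \<and> (\<exists>K\<in>set L. g ` C = set K)))"

text \<open>The words left after deleting the sparsest symbol have tails that form a classified code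
  \<open>K\<close>. Renaming the symbols of the first coordinate turns the deleted symbol into 2;
  asking that \<open>hd K\<close> receive head 0 breaks the remaining symmetry between 0 and
  1.\<close>

lemma normal_form:
  assumes L: "classified n m L" and m: "3 \<le> m" "3 * m < 2 * m' + 3"
    and C: "trifferent (Suc n) C" and card: "m' \<le> card C"
  obtains g K A B V where "symmetry (Suc n) g" "K \<in> set L" "K \<noteq> []" "A \<union> B = set K" "A \<inter> B = {}"
    "hd K \<in> A" "V \<subseteq> ternary_words n" "g ` C = (#) 0 ` A \<union> (#) 1 ` B \<union> (#) 2 ` V"
proof -
  obtain s where s: "s \<in> {0, 1, 2}" "2 * card C \<le> 3 * card {x \<in> C. hd x \<noteq> s}"
    using sparsest_symbol[OF C] .
  let ?R = "{x \<in> C. hd x \<noteq> s}"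
  \<comment> \<open>\<open>3 * card ?R\<close> is at least \<open>2 * m'\<close>, hence exceeds
    \<open>3 * m - 3\<close>; so \<open>m\<close> may be as large as two thirds of \<open>m'\<close>
    rounded up.\<close>
  have R: "m \<le> card ?R"
    using s card m by linarith
  note tails = tails_of_two_symbols[OF C _ s(1)]
  have words: "C \<subseteq> ternary_words (Suc n)"
    using C by (simp add: trifferent_def)
  have "trifferent n (tl ` ?R)" "m \<le> card (tl ` ?R)"
    using tails R m by (auto simp: card_image)
  then have "\<exists>g. symmetry n g \<and> (\<exists>K\<in>set L. g ` tl ` ?R = set K)"
    using L by (simp only: classified_def)
  then obtain g K where g: "symmetry n g" and K: "K \<in> set L" and gK: "g ` tl ` ?R = set K"
    by auto
  have "0 < card ?R"
    using R m by linarith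
  then have "?R \<noteq> {}"
    by (metis card.empty less_irrefl)
  then have "K \<noteq> []"
    using gK by auto
  then have "hd K \<in> g ` tl ` ?R"
    using gK by simp
  then obtain x0 where x0: "x0 \<in> C" "hd x0 \<noteq> s" "g (tl x0) = hd K"
    by auto
  have t: "hd x0 \<in> {0, 1, 2}"
    using x0(1) words ternary_words_SucD(1) by blast
  \<comment> \<open>The word \<open>x0\<close>, whose tail becomes \<open>hd K\<close>, fixes which
    of the two kept symbols is called 0.\<close>
  define \<sigma> where "\<sigma> = (\<lambda>a. if a = s then 2 else if a = hd x0 then 0 else (1 :: nat))"
  define h where "h = (\<lambda>x. \<sigma> (hd x) # g (tl x))"
  have "symmetry (Suc n) h"
    unfolding h_def using s(1) t x0(2) g
    by (intro symmetry_Cons) (auto simp: \<sigma>_def inj_on_def)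
  define C' where "C' = h ` C"
  define A where "A = {v. 0 # v \<in> C'}"
  define B where "B = {v. 1 # v \<in> C'}"
  define V where "V = {v. 2 # v \<in> C'}"
  have C': "trifferent (Suc n) C'"
    unfolding C'_def using \<open>symmetry (Suc n) h\<close> C by (rule symmetry_trifferent)
  then have words': "C' \<subseteq> ternary_words (Suc n)"
    by (simp add: trifferent_def)
  have dec: "C' = (#) 0 ` A \<union> (#) 1 ` B \<union> (#) 2 ` V"
  proof
    show "C' \<subseteq> (#) 0 ` A \<union> (#) 1 ` B \<union> (#) 2 ` V"
    proof
      fix x assume "x \<in> C'"
      moreover from this obtain a v where "x = a # v" "a \<in> {0, 1, 2}"
        using words' ternary_words_SucE by blast
      ultimately show "x \<in> (#) 0 ` A \<union> (#) 1 ` B \<union> (#) 2 ` V"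
        by (auto simp: A_def B_def V_def)
    qed
  qed (auto simp: A_def B_def V_def)
  have hR: "{y \<in> C'. hd y \<noteq> 2} = h ` ?R"
    by (auto simp: C'_def h_def \<sigma>_def split: if_splits)
  have "card (h ` ?R) = card ?R"
    using \<open>symmetry (Suc n) h\<close> words by (intro symmetry_card) auto
  then have "3 \<le> card {y \<in> C'. hd y \<noteq> 2}"
    using R m hR by simp
  from tails_of_two_symbols(1)[OF C' this] have inj: "inj_on tl {y \<in> C'. hd y \<noteq> 2}"
    by simp
  \<comment> \<open>A common tail would belong to two kept words, against injectivity of
    \<open>tl\<close> on them.\<close>
  have "A \<inter> B = {}"
  proof (rule ccontr)
    assume "A \<inter> B \<noteq> {}"
    then obtain v where "0 # v \<in> C'" "1 # v \<in> C'"
      by (auto simp: A_def B_def)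
    then show False
      using inj_onD[OF inj, of "0 # v" "1 # v"] by simp
  qed
  have "{y \<in> C'. hd y \<noteq> 2} = (#) 0 ` A \<union> (#) 1 ` B"
    unfolding dec by auto
  then have "tl ` h ` ?R = A \<union> B"
    using hR by (simp add: image_Un image_image)
  then have "A \<union> B = set K"
    using gK by (simp add: image_image h_def)
  have "h x0 = 0 # hd K"
    using x0 by (simp add: h_def \<sigma>_def)
  then have "hd K \<in> A"
    using x0(1) unfolding A_def C'_def by (metis imageI mem_Collect_eq)
  have "V \<subseteq> ternary_words n"
    using words' Cons_in_ternary_words unfolding V_def by blast
  show ?thesis
    using \<open>symmetry (Suc n) h\<close> K \<open>K \<noteq> []\<close> \<open>A \<union> B = set K\<close> \<open>A \<inter> B = {}\<close> \<open>hd K \<in> A\<close>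
      \<open>V \<subseteq> ternary_words n\<close> dec unfolding C'_def by (rule that)
qed

section \<open>Enumerating the extensions\<close>

fun all_words :: "nat \<Rightarrow> nat list list" where
  "all_words 0 = [[]]"
| "all_words (Suc n) = concat (map (\<lambda>a. map ((#) a) (all_words n)) [0, 1, 2])"

lemma set_all_words: "set (all_words n) = ternary_words n"
proof (induction n)
  case 0
  then show ?case by (auto simp: ternary_words_def)
next
  case (Suc n)
  have "x \<in> set (all_words (Suc n)) \<longleftrightarrow> x \<in> ternary_words (Suc n)" for x
    by (cases x) (auto simp: Suc.IH simp: ternary_words_def)
  then show ?case by blast
qed

lemma distinct_all_words: "distinct (all_words n)"
  by (induction n) (auto simp: distinct_map)

text \<open>The words of \<open>V\<close> have been chosen, the candidates in the last argument are compatible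
  with them, and at least \<open>r\<close> more words are wanted.\<close>

fun extensions :: "nat list list \<Rightarrow> nat \<Rightarrow> nat list list \<Rightarrow> nat list list \<Rightarrow> nat list list list" where
  "extensions K r V [] = (if r = 0 then [V] else [])"
| "extensions K r V (w # ws) = (if length (w # ws) < r then [] else
     extensions K r V ws @
     extensions K (r - 1) (w # V) (filter (\<lambda>u. \<forall>x\<in>set (K @ V). separated x w u) ws))"

text \<open>The search branches on whether \<open>w\<close> lies in \<open>V\<close>. The length
  test never cuts off \<open>V\<close>, since \<open>r\<close> further words of it are still among
  the candidates; the filter discards only words that cannot join \<open>w\<close> in
  \<open>V\<close>.\<close>

lemma extensions_complete:
  assumes "set V0 \<subseteq> V" "V \<subseteq> set V0 \<union> set ws" "distinct (V0 @ ws)" "r \<le> card (V \<inter> set ws)"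
    and "\<And>x u w. x \<in> set K \<Longrightarrow> u \<in> V \<Longrightarrow> w \<in> V \<Longrightarrow> u \<noteq> w \<Longrightarrow> separated x u w"
    and "\<And>u v w. u \<in> V \<Longrightarrow> v \<in> V \<Longrightarrow> w \<in> V \<Longrightarrow> u \<noteq> v \<Longrightarrow> v \<noteq> w \<Longrightarrow> u \<noteq> w \<Longrightarrow> separated u v w"
  shows "\<exists>E\<in>set (extensions K r V0 ws). set E = V"
  using assms
proof (induction K r V0 ws rule: extensions.induct)
  case (1 K r V0)
  then show ?case by auto
next
  case (2 K r V0 w ws)
  have "card (V \<inter> set (w # ws)) \<le> card (set (w # ws))"
    by (intro card_mono) auto
  also have "\<dots> \<le> length (w # ws)"
    by (rule card_length)
  finally have len: "\<not> length (w # ws) < r"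
    using "2.prems"(4) by linarith
  show ?case
  proof (cases "w \<in> V")
    case False
    then have "\<exists>E\<in>set (extensions K r V0 ws). set E = V"
      using "2.prems" by (intro "2.IH"(1)[OF len]) auto
    then show ?thesis using len by auto
  next
    case True
    let ?ws = "filter (\<lambda>u. \<forall>x\<in>set (K @ V0). separated x w u) ws"
    have keep: "V \<inter> set ws \<subseteq> set ?ws"
    proof
      fix u assume u: "u \<in> V \<inter> set ws"
      have "separated x w u" if "x \<in> set (K @ V0)" for x
      proof (cases "x \<in> set K")
        case True
        then show ?thesis
          using u \<open>w \<in> V\<close> "2.prems"(3,5) by auto
      next
        case False
        then have "x \<in> set V0"
          using that by simp
        then have "x \<in> V" "w \<noteq> u" "x \<noteq> w" "x \<noteq> u"
          using u "2.prems"(1,3) by auto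
        then show ?thesis
          using u \<open>w \<in> V\<close> "2.prems"(6) by blast
      qed
      then show "u \<in> set ?ws" using u by simp
    qed
    have "V \<inter> set (w # ws) = insert w (V \<inter> set ?ws)"
      using True keep by auto
    moreover have "w \<notin> V \<inter> set ?ws"
      using "2.prems"(3) by auto
    ultimately have "card (V \<inter> set (w # ws)) = Suc (card (V \<inter> set ?ws))"
      by simp
    \<comment> \<open>Subtraction truncates at 0, so after the quota is met the search still allows
      further words.\<close>
    then have "r - 1 \<le> card (V \<inter> set ?ws)"
      using "2.prems"(4) by linarith
    then have "\<exists>E\<in>set (extensions K (r - 1) (w # V0) ?ws). set E = V"
      using "2.prems"(1,2,3,5,6) keep True by (intro "2.IH"(2)[OF len]) auto
    then show ?thesis using len by auto
  qed
qed

text \<open>The tails \<open>A\<close> and \<open>B\<close> have received the heads 0 and 1, those in the last argument have not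
  received a head yet, and \<open>ws\<close> lists the tails that are still possible with head 2.\<close>

fun coloured_extensions :: "nat list list \<Rightarrow> nat \<Rightarrow> nat list list \<Rightarrow> nat list list \<Rightarrow>
    nat list list \<Rightarrow> nat list list \<Rightarrow> nat list list list" where
  "coloured_extensions K r A B ws [] =
     map (\<lambda>V. map ((#) 0) A @ map ((#) 1) B @ map ((#) 2) V) (extensions K r [] ws)"
| "coloured_extensions K r A B ws (k # ks) = (if length ws < r then [] else
     coloured_extensions K r (k # A) B (filter (\<lambda>w. \<forall>x\<in>set A. separated k x w) ws) ks @
     coloured_extensions K r A (k # B) (filter (\<lambda>w. \<forall>x\<in>set B. separated k x w) ws) ks)"

text \<open>Two words with the same head 0 or 1 and a word of head 2 are not separated by their
  heads, so their tails must be separated. Hence the filter removes no element of \<open>V\<close>,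
  and the true colouring of \<open>K\<close> survives to a leaf of the search.\<close>

lemma coloured_extensions_complete:
  assumes "set A0 \<subseteq> A" "set B0 \<subseteq> B" "A \<union> B = set A0 \<union> set B0 \<union> set ks" "A \<inter> B = {}"
    "distinct (A0 @ B0 @ ks)" "A \<union> B = set K" "V \<subseteq> set ws" "distinct ws" "r \<le> card V"
    and C: "trifferent (Suc n) ((#) 0 ` A \<union> (#) 1 ` B \<union> (#) 2 ` V)"
  shows "\<exists>E\<in>set (coloured_extensions K r A0 B0 ws ks). set E = (#) 0 ` A \<union> (#) 1 ` B \<union> (#) 2 ` V"
  using assms(1-9)
proof (induction K r A0 B0 ws ks rule: coloured_extensions.induct)
  case (1 K r A0 B0 ws)
  have sep: "separated x y z"
    if "x \<in> (#) 0 ` A \<union> (#) 1 ` B \<union> (#) 2 ` V" "y \<in> (#) 2 ` V" "z \<in> (#) 2 ` V"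
      "x \<noteq> y" "y \<noteq> z" "x \<noteq> z" for x y z
    using that C by (intro trifferent_separated[OF C]) auto
  have "separated x u w" if "x \<in> set K" "u \<in> V" "w \<in> V" "u \<noteq> w" for x u w
  proof -
    have "x \<in> A \<or> x \<in> B"
      using that "1.prems"(6) by blast
    then show ?thesis
      using sep[of "0 # x" "2 # u" "2 # w"] sep[of "1 # x" "2 # u" "2 # w"] that by auto
  qed
  moreover have "separated u v w"
    if "u \<in> V" "v \<in> V" "w \<in> V" "u \<noteq> v" "v \<noteq> w" "u \<noteq> w" for u v w
    using sep[of "2 # u" "2 # v" "2 # w"] that by auto
  moreover have "V \<inter> set ws = V"
    using "1.prems"(7) by blast
  ultimately have "\<exists>E\<in>set (extensions K r [] ws). set E = V"
    using "1.prems"(7-9) by (intro extensions_complete) auto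
  then obtain E where E: "E \<in> set (extensions K r [] ws)" "set E = V"
    by blast
  \<comment> \<open>All tails are coloured now, and disjointness of \<open>A\<close> and
    \<open>B\<close> leaves no freedom.\<close>
  have AB: "A = set A0" "B = set B0"
    using "1.prems"(1-4) by auto
  show ?case
    using E by (auto simp: AB intro!: bexI[of _ E])
next
  case (2 K r A0 B0 ws k ks)
  have "card V \<le> card (set ws)"
    using "2.prems"(7) by (intro card_mono) auto
  also have "\<dots> \<le> length ws"
    by (rule card_length)
  finally have len: "\<not> length ws < r"
    using "2.prems"(9) by linarith
  have "k \<in> A \<or> k \<in> B"
    using "2.prems"(3) by auto
  then show ?case
  proof
    assume k: "k \<in> A"
    have "separated k x w" if "x \<in> set A0" "w \<in> V" for x w
    proof -
      have "x \<in> A" "k \<noteq> x"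
        using that "2.prems"(1,5) by auto
      then show ?thesis
        using trifferent_separated[OF C, of "0 # k" "0 # x" "2 # w"] k that by auto
    qed
    then have "V \<subseteq> set (filter (\<lambda>w. \<forall>x\<in>set A0. separated k x w) ws)"
      using "2.prems"(7) by auto
    then have "\<exists>E\<in>set (coloured_extensions K r (k # A0) B0
        (filter (\<lambda>w. \<forall>x\<in>set A0. separated k x w) ws) ks). set E = (#) 0 ` A \<union> (#) 1 ` B \<union> (#) 2 ` V"
      using "2.prems" k by (intro "2.IH"(1)[OF len]) auto
    then show ?thesis using len by auto
  next
    assume k: "k \<in> B"
    have "separated k x w" if "x \<in> set B0" "w \<in> V" for x w
    proof -
      have "x \<in> B" "k \<noteq> x"
        using that "2.prems"(2,5) by auto
      then show ?thesis
        using trifferent_separated[OF C, of "1 # k" "1 # x" "2 # w"] k that by auto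
    qed
    then have "V \<subseteq> set (filter (\<lambda>w. \<forall>x\<in>set B0. separated k x w) ws)"
      using "2.prems"(7) by auto
    then have "\<exists>E\<in>set (coloured_extensions K r A0 (k # B0)
        (filter (\<lambda>w. \<forall>x\<in>set B0. separated k x w) ws) ks). set E = (#) 0 ` A \<union> (#) 1 ` B \<union> (#) 2 ` V"
      using "2.prems" k by (intro "2.IH"(2)[OF len]) auto
    then show ?thesis using len by auto
  qed
qed

text \<open>A certificate \<open>(j, g)\<close> for an extension says that \<open>g\<close> maps it to the \<open>j\<close>-th code of \<open>L'\<close>.\<close>

definition extensions_certified ::
  "nat \<Rightarrow> nat \<Rightarrow> nat list list list \<Rightarrow> nat list list \<Rightarrow> (nat \<times> (nat \<times> nat) list) list \<Rightarrow> bool" where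
  "extensions_certified n m' L' K certs \<longleftrightarrow> distinct K \<and>
     list_all2 (\<lambda>(j, g) E. j < length L' \<and> valid_relabelling (Suc n) g \<and>
        set (map (relabel g) E) = set (L' ! j)) certs
       (coloured_extensions K (m' - length K) [hd K] [] (all_words n) (tl K))"

section \<open>The certified step from length \<open>n\<close> to \<open>n + 1\<close>\<close>

text \<open>A symmetry brings the code to normal form, the complete search lists the result, and the
  certified relabelling, composed with that symmetry, leads to an entry of
  \<open>L'\<close>.\<close>

lemma classified_Suc:
  assumes L: "classified n m L" and m: "3 \<le> m" "3 * m < 2 * m' + 3"
    and certs: "list_all2 (extensions_certified n m' L') L certss"
  shows "classified (Suc n) m' L'"
  unfolding classified_def
proof (intro allI impI)
  fix C assume C: "trifferent (Suc n) C" and card: "m' \<le> card C"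
  obtain g K A B V where g: "symmetry (Suc n) g" and K: "K \<in> set L" "K \<noteq> []"
    and AB: "A \<union> B = set K" "A \<inter> B = {}" "hd K \<in> A" and V: "V \<subseteq> ternary_words n"
    and gC: "g ` C = (#) 0 ` A \<union> (#) 1 ` B \<union> (#) 2 ` V"
    using normal_form[OF L m C card] .
  obtain certs where "extensions_certified n m' L' K certs"
    using certs K(1) unfolding list_all2_conv_all_nth by (metis in_set_conv_nth)
  then have dist: "distinct K" and ok: "list_all2 (\<lambda>(j, g) E. j < length L' \<and>
        valid_relabelling (Suc n) g \<and> set (map (relabel g) E) = set (L' ! j)) certs
       (coloured_extensions K (m' - length K) [hd K] [] (all_words n) (tl K))"
    unfolding extensions_certified_def by auto
  have fin: "finite A" "finite B" "finite V"
    using AB(1) V finite_ternary_words finite_subset by (metis finite_Un finite_set)+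
  have "card C = card (g ` C)"
    using g C by (intro symmetry_card[symmetric]) (auto simp: trifferent_def)
  also have "\<dots> = card ((#) 0 ` A \<union> (#) 1 ` B) + card ((#) 2 ` V)"
    unfolding gC using fin by (intro card_Un_disjoint) auto
  also have "card ((#) 0 ` A \<union> (#) 1 ` B) = card A + card B"
    using fin by (subst card_Un_disjoint) (auto simp: card_image)
  also have "card A + card B = length K"
    using AB fin dist by (metis card_Un_disjoint distinct_card)
  also have "card ((#) 2 ` V) = card V"
    by (simp add: card_image)
  \<comment> \<open>Heads 0 and 1 account for exactly \<open>length K\<close> words; head 2 must
    supply the rest.\<close>
  finally have "m' - length K \<le> card V"
    using card by simp
  moreover have "trifferent (Suc n) ((#) 0 ` A \<union> (#) 1 ` B \<union> (#) 2 ` V)"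
    using symmetry_trifferent[OF g C] gC by simp
  \<comment> \<open>The search starts with \<open>hd K\<close> already coloured 0, as the normal
    form permits.\<close>
  moreover have "K = hd K # tl K"
    using K(2) by simp
  then have "A \<union> B = set [hd K] \<union> set [] \<union> set (tl K)" "distinct ([hd K] @ [] @ tl K)"
    using AB(1) dist by (metis Un_empty_right append_Cons append_Nil empty_set set_append, simp)
  ultimately have "\<exists>E\<in>set (coloured_extensions K (m' - length K) [hd K] [] (all_words n) (tl K)).
      set E = (#) 0 ` A \<union> (#) 1 ` B \<union> (#) 2 ` V"
    using AB V by (intro coloured_extensions_complete) (auto simp: set_all_words distinct_all_words)
  then obtain E where E: "set E = g ` C"
    "E \<in> set (coloured_extensions K (m' - length K) [hd K] [] (all_words n) (tl K))"
    unfolding gC by blast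
  then obtain j h where jh: "j < length L'" "valid_relabelling (Suc n) h"
    "set (map (relabel h) E) = set (L' ! j)"
    using ok unfolding list_all2_conv_all_nth by (auto simp: in_set_conv_nth)
  show "\<exists>g. symmetry (Suc n) g \<and> (\<exists>K\<in>set L'. g ` C = set K)"
  proof (intro exI conjI bexI)
    show "symmetry (Suc n) (relabel h \<circ> g)"
      using symmetry_relabel[OF jh(2)] g by (rule symmetry_comp)
    show "(relabel h \<circ> g) ` C = set (L' ! j)"
      using jh(3) E(1) by (simp add: image_comp)
    show "L' ! j \<in> set L'"
      using jh(1) by simp
  qed
qed

section \<open>The classification\<close>

definition codes1 :: "nat list list list" where
  "codes1 =
    [[[0], [1], [2]]]"

definition codes2 :: "nat list list list" where
  "codes2 =
    [[[0,0], [0,1], [1,2], [2,2]]]"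

definition codes3 :: "nat list list list" where
  "codes3 =
    [[[0,0,0], [0,0,1], [0,1,2], [1,2,2], [2,2,2]],
     [[0,0,0], [0,1,2], [1,0,1], [1,2,2], [2,2,0]],
     [[0,0,0], [0,1,2], [1,0,1], [1,2,2], [2,1,1], [2,2,0]]]"

text \<open>The last entry is the linear tetracode over the field with three elements; the two
  entries before it are subsets of it.\<close>

definition codes4 :: "nat list list list" where
  "codes4 =
    [[[0,0,0,0], [0,0,0,1], [0,1,2,2], [1,0,1,2], [1,2,2,2], [2,1,1,2], [2,2,0,2]],
     [[0,0,0,0], [0,0,1,2], [0,1,2,2], [1,0,0,1], [1,2,2,2], [2,2,1,1], [2,2,2,0]],
     [[0,0,0,0], [0,0,1,2], [0,1,2,2], [1,0,0,1], [1,2,2,2], [2,1,0,1], [2,2,1,1], [2,2,2,0]],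
     [[0,0,0,0], [0,1,2,2], [1,0,1,2], [1,1,0,1], [1,2,2,0], [2,1,1,0], [2,2,0,2]],
     [[0,0,0,0], [0,1,2,2], [1,0,1,2], [1,1,0,1], [1,2,2,0], [2,0,2,1], [2,1,1,0], [2,2,0,2]],
     [[0,0,0,0], [0,1,2,2], [0,2,1,1], [1,0,1,2], [1,1,0,1], [1,2,2,0], [2,0,2,1], [2,1,1,0],
      [2,2,0,2]]]"

text \<open>The first entry is the tetracode with 2 appended to each nonzero word and both 0 and 1
  appended to the zero word.\<close>

definition codes5 :: "nat list list list" where
  "codes5 =
    [[[0,0,0,0,0], [0,0,0,0,1], [0,1,2,2,2], [0,2,1,1,2], [1,0,1,2,2], [1,1,0,1,2], [1,2,2,0,2],
      [2,0,2,1,2], [2,1,1,0,2], [2,2,0,2,2]],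
     [[0,0,0,0,0], [0,0,1,2,2], [0,1,0,1,2], [0,2,2,0,2], [1,0,0,0,1], [1,1,2,2,2], [1,2,1,1,2],
      [2,0,2,1,1], [2,1,1,0,1], [2,2,0,2,1]],
     [[0,0,0,0,0], [0,0,1,2,2], [0,1,2,2,2], [0,2,2,1,1], [1,0,0,1,2], [1,1,0,0,1], [1,2,2,2,0],
      [2,0,0,2,1], [2,2,1,1,0], [2,2,2,0,2]],
     [[0,0,0,0,0], [0,0,0,1,2], [0,0,1,2,2], [0,1,0,0,1], [1,1,2,2,2], [1,2,1,0,1], [1,2,2,1,1],
      [1,2,2,2,0], [2,0,2,2,2], [2,2,0,0,1]],
     [[0,0,0,0,0], [0,0,0,1,2], [0,1,2,2,2], [0,2,1,0,1], [1,0,1,2,2], [1,1,0,0,1], [1,2,2,1,1],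
      [1,2,2,2,0], [2,0,2,0,1], [2,2,0,2,2]]]"

text \<open>There are only three words of length 1, so a code with three of them consists of
  all.\<close>

lemma classified_1: "classified 1 3 codes1"
  unfolding classified_def
proof (intro allI impI)
  fix C assume C: "trifferent 1 C" "3 \<le> card C"
  have words: "ternary_words 1 = set (hd codes1)"
    unfolding set_all_words[symmetric] by (simp add: codes1_def)
  have "C = set (hd codes1)"
  proof (rule card_seteq)
    show "C \<subseteq> set (hd codes1)"
      using C(1) words by (simp add: trifferent_def)
    show "card (set (hd codes1)) \<le> card C"
      using C(2) by (simp add: codes1_def)
  qed simp
  then show "\<exists>g. symmetry 1 g \<and> (\<exists>K\<in>set codes1. g ` C = set K)"
    by (intro exI[of _ id]) (simp add: symmetry_id codes1_def)
qed

text \<open>The certificates come from a backtracking isomorphism search and are listed in the order in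
  which the enumeration produces the extensions.\<close>

lemma certified_1: "list_all2 (extensions_certified 1 4 codes2) codes1
    [[(0,[(0,0),(1,0)]), (0,[(0,0),(1,1)]), (0,[(0,2),(1,4)])]]"
  by code_simp

lemma certified_2: "list_all2 (extensions_certified 2 5 codes3) codes2
    [[(0,[(0,0),(1,0),(2,0)]), (0,[(0,0),(1,1),(2,0)]), (0,[(1,0),(0,1),(2,0)]),
      (0,[(0,0),(2,3),(1,4)]), (1,[(0,0),(1,0),(2,0)]), (1,[(0,0),(2,3),(1,4)]),
      (2,[(0,0),(1,0),(2,0)]), (1,[(0,0),(2,3),(1,5)]), (1,[(0,0),(1,1),(2,0)]),
      (2,[(0,0),(1,1),(2,0)]), (0,[(0,2),(2,5),(1,4)])]]"
  by code_simp

lemma certified_3: "list_all2 (extensions_certified 3 7 codes4) codes3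
    [[(0,[(0,0),(1,0),(2,0),(3,0)]), (0,[(0,0),(1,1),(2,0),(3,0)]), (1,[(0,0),(1,0),(2,0),(3,0)]),
      (1,[(1,0),(2,0),(3,2),(0,4)]), (1,[(0,0),(3,3),(2,5),(1,4)]), (2,[(0,0),(1,0),(2,0),(3,0)]),
      (1,[(1,1),(2,0),(3,2),(0,4)]), (1,[(0,0),(3,3),(2,5),(1,5)]), (1,[(0,0),(1,1),(2,0),(3,0)]),
      (2,[(0,0),(1,1),(2,0),(3,0)]), (0,[(0,2),(3,5),(2,5),(1,4)]), (0,[(0,0),(3,3),(2,5),(1,4)]),
      (1,[(1,1),(2,0),(3,0),(0,1)]), (1,[(0,2),(3,5),(2,5),(1,5)]), (1,[(0,2),(1,1),(2,0),(3,2)]),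
      (2,[(0,2),(1,1),(2,0),(3,2)]), (1,[(0,2),(1,0),(2,0),(3,2)]), (1,[(1,0),(2,0),(3,0),(0,1)]),
      (1,[(0,2),(3,5),(2,5),(1,4)]), (2,[(0,2),(1,0),(2,0),(3,2)])],
     [(1,[(0,1),(2,0),(3,2),(1,4)]), (1,[(1,0),(2,0),(3,2),(0,5)]), (1,[(0,1),(1,1),(2,2),(3,5)]),
      (1,[(0,4),(1,4),(3,4),(2,0)]), (1,[(1,2),(3,5),(2,4),(0,5)]), (1,[(0,1),(3,0),(1,3),(2,5)]),
      (1,[(0,4),(2,5),(1,5),(3,0)]), (1,[(2,3),(1,4),(3,4),(0,5)]), (3,[(0,0),(1,0),(2,0),(3,0)]),
      (3,[(0,0),(1,2),(3,5),(2,5)]), (3,[(0,0),(2,1),(3,0),(1,1)]), (4,[(0,0),(1,0),(2,0),(3,0)]),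
      (1,[(0,4),(3,5),(2,4),(1,1)])],
     [(0,[(1,3),(3,0),(2,3),(0,4)]), (0,[(1,3),(2,4),(3,4),(0,4)]), (0,[(1,2),(3,5),(2,5),(0,4)]),
      (1,[(1,5),(0,4),(2,5),(3,1)]), (1,[(1,0),(0,1),(2,0),(3,0)]), (2,[(0,1),(1,0),(3,3),(2,4)]),
      (0,[(1,2),(2,1),(3,2),(0,4)]), (1,[(1,5),(0,4),(3,2),(2,2)]), (1,[(1,0),(0,1),(3,3),(2,4)]),
      (2,[(0,1),(1,0),(2,0),(3,0)]), (1,[(1,4),(0,4),(2,3),(3,3)]), (1,[(1,1),(0,1),(2,2),(3,5)]),
      (2,[(0,1),(1,1),(3,1),(2,1)]), (1,[(1,4),(0,4),(3,4),(2,0)]), (1,[(1,1),(0,1),(3,1),(2,1)]),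
      (2,[(0,1),(1,1),(2,2),(3,5)]), (0,[(1,0),(3,3),(2,4),(0,4)]), (1,[(1,3),(0,4),(2,4),(3,4)]),
      (1,[(1,2),(0,1),(2,1),(3,2)]), (2,[(0,1),(1,2),(3,5),(2,5)]), (1,[(2,5),(0,4),(3,3),(1,2)]),
      (1,[(2,0),(0,1),(3,2),(1,4)]), (2,[(0,1),(2,0),(1,0),(3,1)]), (1,[(2,4),(0,4),(3,5),(1,0)]),
      (1,[(2,1),(0,1),(3,0),(1,1)]), (2,[(0,1),(2,1),(1,2),(3,4)]), (3,[(1,1),(2,2),(3,5),(0,4)]),
      (3,[(1,0),(2,0),(3,0),(0,1)]), (4,[(0,3),(1,4),(2,4),(3,0)]), (3,[(1,2),(2,1),(3,2),(0,4)]),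
      (4,[(0,3),(1,1),(3,2),(2,5)]), (4,[(0,3),(1,0),(2,3),(3,4)]), (5,[(0,0),(1,0),(2,0),(3,0)]),
      (1,[(2,3),(0,1),(3,1),(1,3)]), (1,[(2,2),(0,4),(3,4),(1,5)]), (2,[(0,1),(2,3),(1,4),(3,5)]),
      (1,[(1,3),(0,1),(3,0),(2,3)]), (1,[(1,2),(0,4),(3,5),(2,5)]), (2,[(0,1),(1,3),(2,4),(3,4)]),
      (0,[(1,0),(2,0),(3,0),(0,1)])]]"
  by code_simp

text \<open>The nine-word tetracode needs only one word of head 2 to reach size 10, so most of the
  extensions arise from it.\<close>

lemma certified_4: "list_all2 (extensions_certified 4 10 codes5) codes4
    [[(0,[(0,0),(1,0),(2,0),(3,0),(4,0)]), (1,[(0,0),(1,0),(2,0),(3,0),(4,0)]),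
      (1,[(0,2),(1,0),(2,0),(3,0),(4,2)])],
     [(2,[(0,0),(1,0),(2,0),(3,0),(4,0)]), (1,[(1,0),(0,0),(4,3),(3,5),(2,4)]),
      (1,[(3,5),(0,2),(4,3),(1,0),(2,2)]), (2,[(0,2),(3,5),(2,5),(1,5),(4,0)])],
     [(3,[(0,0),(1,0),(2,0),(3,0),(4,0)]), (3,[(0,0),(1,0),(4,3),(3,5),(2,4)]),
      (3,[(0,0),(2,0),(3,0),(4,2),(1,4)]), (4,[(0,0),(1,0),(2,0),(3,0),(4,0)]),
      (4,[(0,0),(2,0),(3,0),(4,2),(1,4)]), (4,[(0,0),(3,5),(4,3),(1,0),(2,2)]),
      (3,[(0,0),(3,0),(4,2),(1,5),(2,4)]), (4,[(0,0),(1,5),(4,2),(3,0),(2,2)])],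
     [(1,[(0,1),(1,2),(3,1),(2,2),(4,4)]), (1,[(0,4),(1,2),(2,2),(3,1),(4,2)])],
     [(2,[(2,0),(1,3),(0,4),(3,5),(4,4)]), (2,[(2,2),(1,2),(0,1),(3,0),(4,2)]),
      (4,[(2,0),(3,0),(4,0),(1,3),(0,5)]), (4,[(1,4),(2,1),(4,5),(0,1),(3,2)]),
      (2,[(1,3),(0,4),(3,5),(4,4),(2,1)]), (2,[(1,2),(0,1),(3,0),(4,2),(2,4)]),
      (4,[(1,4),(3,5),(4,0),(2,4),(0,5)]), (2,[(1,3),(0,4),(2,4),(3,4),(4,0)]),
      (2,[(1,2),(0,1),(2,1),(3,2),(4,5)]), (4,[(1,4),(3,5),(4,0),(0,4),(2,5)]),
      (2,[(1,2),(0,4),(2,4),(4,4),(3,0)]), (2,[(1,3),(0,1),(2,1),(4,2),(3,5)]),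
      (4,[(1,4),(2,4),(3,0),(4,5),(0,5)]), (2,[(1,3),(0,4),(4,5),(2,5),(3,0)]),
      (2,[(1,2),(0,1),(4,0),(2,3),(3,5)]), (4,[(1,4),(2,1),(4,5),(3,0),(0,3)]),
      (2,[(1,2),(0,4),(3,5),(2,5),(4,0)]), (2,[(1,3),(0,1),(3,0),(2,3),(4,5)]),
      (4,[(1,4),(2,4),(3,0),(0,4),(4,4)]), (2,[(1,2),(0,4),(4,5),(3,4),(2,1)]),
      (2,[(1,3),(0,1),(4,0),(3,2),(2,4)]), (2,[(2,2),(1,3),(0,1),(4,0),(3,2)]),
      (2,[(2,0),(1,2),(0,4),(4,5),(3,4)]), (4,[(2,0),(3,0),(4,0),(0,1),(1,1)])],
     [(0,[(1,3),(2,3),(3,0),(4,3),(0,4)]), (0,[(1,3),(2,2),(4,1),(3,2),(0,4)]),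
      (0,[(1,3),(2,0),(3,3),(4,4),(0,4)]), (0,[(1,2),(2,3),(4,0),(3,3),(0,4)]),
      (1,[(1,0),(2,3),(4,0),(3,3),(0,5)]), (0,[(1,2),(2,2),(3,1),(4,2),(0,4)]),
      (1,[(1,0),(2,2),(3,1),(4,2),(0,5)]), (1,[(1,5),(2,0),(3,4),(4,3),(0,3)]),
      (0,[(1,2),(2,0),(4,3),(3,4),(0,4)]), (1,[(1,0),(2,0),(4,3),(3,4),(0,5)]),
      (1,[(1,5),(2,2),(4,2),(3,1),(0,3)]), (1,[(1,5),(2,3),(3,3),(4,0),(0,3)]),
      (1,[(1,1),(2,3),(3,0),(4,3),(0,5)]), (1,[(1,1),(2,2),(4,1),(3,2),(0,5)]),
      (1,[(1,4),(2,0),(4,4),(3,3),(0,3)]), (1,[(1,1),(2,0),(3,3),(4,4),(0,5)]),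
      (1,[(1,4),(2,2),(3,2),(4,1),(0,3)]), (1,[(1,4),(2,3),(4,3),(3,0),(0,3)]),
      (0,[(1,0),(2,3),(3,4),(4,4),(0,4)]), (1,[(1,2),(2,3),(3,4),(4,4),(0,5)]),
      (1,[(2,0),(1,3),(4,0),(3,2),(0,5)]), (1,[(2,2),(1,3),(3,5),(4,4),(0,5)]),
      (1,[(4,1),(1,3),(3,0),(2,3),(0,5)]), (1,[(4,3),(1,3),(2,4),(3,4),(0,5)]),
      (1,[(2,0),(1,2),(3,0),(4,2),(0,5)]), (1,[(2,5),(1,0),(3,5),(4,3),(0,3)]),
      (1,[(4,3),(1,2),(3,5),(2,5),(0,5)]), (1,[(4,2),(1,0),(3,0),(2,0),(0,3)]),
      (1,[(3,3),(1,3),(4,5),(2,5),(0,5)]), (1,[(3,1),(1,3),(2,1),(4,2),(0,5)]),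
      (1,[(2,2),(1,2),(4,5),(3,4),(0,5)]), (1,[(3,1),(1,2),(4,0),(2,3),(0,5)]),
      (1,[(2,3),(1,0),(4,0),(3,1),(0,3)]), (1,[(3,4),(1,0),(4,5),(2,2),(0,3)]),
      (1,[(3,3),(1,2),(2,4),(4,4),(0,5)]), (1,[(3,2),(1,0),(2,1),(4,1),(0,3)]),
      (1,[(4,1),(1,2),(2,1),(3,2),(0,5)]), (1,[(4,4),(1,0),(2,4),(3,3),(0,3)]),
      (1,[(1,3),(2,3),(4,4),(3,4),(0,5)]), (0,[(1,0),(2,2),(4,5),(3,5),(0,4)]),
      (1,[(1,2),(2,2),(4,5),(3,5),(0,5)]), (1,[(3,2),(1,3),(2,5),(4,5),(0,5)]),
      (1,[(3,0),(1,3),(4,1),(2,2),(0,5)]), (1,[(2,1),(1,3),(3,1),(4,3),(0,5)]),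
      (1,[(2,3),(1,3),(4,4),(3,5),(0,5)]), (1,[(2,1),(1,2),(4,1),(3,3),(0,5)]),
      (1,[(2,4),(1,0),(4,4),(3,2),(0,3)]), (1,[(3,2),(1,2),(4,4),(2,4),(0,5)]),
      (1,[(3,3),(1,0),(4,1),(2,1),(0,3)]), (1,[(4,2),(1,3),(3,4),(2,4),(0,5)]),
      (1,[(4,0),(1,3),(2,0),(3,3),(0,5)]), (1,[(4,2),(1,2),(2,5),(3,5),(0,5)]),
      (1,[(4,3),(1,0),(2,0),(3,0),(0,3)]), (1,[(3,0),(1,2),(2,0),(4,3),(0,5)]),
      (1,[(3,5),(1,0),(2,5),(4,2),(0,3)]), (1,[(4,0),(1,2),(3,1),(2,2),(0,5)]),
      (1,[(2,3),(1,2),(3,4),(4,5),(0,5)]), (1,[(4,5),(1,0),(3,4),(2,3),(0,3)]),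
      (1,[(2,2),(1,0),(3,1),(4,0),(0,3)]), (1,[(1,3),(2,2),(3,5),(4,5),(0,5)]),
      (1,[(1,3),(2,0),(4,0),(3,0),(0,3)]), (1,[(2,0),(1,0),(4,3),(3,5),(0,5)]),
      (1,[(2,5),(1,2),(4,2),(3,0),(0,3)]), (1,[(3,0),(1,0),(4,2),(2,5),(0,5)]),
      (1,[(3,5),(1,2),(4,3),(2,0),(0,3)]), (1,[(2,1),(1,0),(3,2),(4,4),(0,5)]),
      (1,[(2,4),(1,2),(3,3),(4,1),(0,3)]), (1,[(4,1),(1,0),(3,3),(2,4),(0,5)]),
      (1,[(4,4),(1,2),(3,2),(2,1),(0,3)]), (1,[(2,5),(1,3),(3,2),(4,0),(0,3)]),
      (1,[(2,4),(1,3),(4,3),(3,1),(0,3)]), (1,[(4,0),(1,0),(2,3),(3,4),(0,5)]),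
      (1,[(3,1),(1,0),(2,2),(4,5),(0,5)]), (1,[(4,5),(1,2),(2,2),(3,1),(0,3)]),
      (1,[(3,4),(1,2),(2,3),(4,0),(0,3)]), (1,[(3,4),(1,3),(4,2),(2,1),(0,3)]),
      (1,[(3,5),(1,3),(2,2),(4,1),(0,3)]), (1,[(4,5),(1,3),(3,3),(2,0),(0,3)]),
      (1,[(4,4),(1,3),(2,3),(3,0),(0,3)]), (1,[(1,2),(2,0),(3,0),(4,0),(0,3)]),
      (0,[(1,0),(2,0),(3,0),(4,0),(0,1)])]]"
  by code_simp

text \<open>Each code in \<open>codes5\<close> has ten words and would need four of head 2. The
  empty certificate lists match only if the search finds no extension at all.\<close>

lemma certified_5: "list_all2 (extensions_certified 5 14 []) codes5 [[], [], [], [], []]"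
  by code_simp

text \<open>Among the thresholds 3, 4, 5, 7, 10, 14 each is two thirds of the next one rounded up,
  as the side conditions of the step require.\<close>

lemma classified_6: "classified 6 14 []"
proof -
  have "classified 2 4 codes2"
    using classified_Suc[OF classified_1 _ _ certified_1] by (simp add: numeral_2_eq_2)
  then have "classified 3 5 codes3"
    using classified_Suc[OF _ _ _ certified_2] by simp
  then have "classified 4 7 codes4"
    using classified_Suc[OF _ _ _ certified_3] by simp
  then have "classified 5 10 codes5"
    using classified_Suc[OF _ _ _ certified_4] by simp
  then show ?thesis
    using classified_Suc[OF _ _ _ certified_5] by simp
qed

section \<open>The bound\<close>

text \<open>Rounding down at every length is essential: without it, 13 would grow to about 148
  instead of 141, too much for the constant 1.09.\<close>

lemma trifferent_12_card:
  assumes "trifferent 12 C"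
  shows "card C \<le> 141"
proof -
  have "card D \<le> 13" if "trifferent 6 D" for D
  proof (rule ccontr)
    assume "\<not> card D \<le> 13"
    then have "14 \<le> card D"
      by simp
    then show False
      using classified_6 that unfolding classified_def by auto
  qed
  then have "2 * card D \<le> 3 * 13" if "trifferent 7 D" for D
    using code_size_recursion[of 6 13 D] that by simp
  then have "card D \<le> 19" if "trifferent 7 D" for D
    using that by fastforce
  then have "2 * card D \<le> 3 * 19" if "trifferent 8 D" for D
    using code_size_recursion[of 7 19 D] that by simp
  then have "card D \<le> 28" if "trifferent 8 D" for D
    using that by fastforce
  then have "2 * card D \<le> 3 * 28" if "trifferent 9 D" for D
    using code_size_recursion[of 8 28 D] that by simp
  then have "card D \<le> 42" if "trifferent 9 D" for D
    using that by fastforce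
  then have "2 * card D \<le> 3 * 42" if "trifferent 10 D" for D
    using code_size_recursion[of 9 42 D] that by simp
  then have "card D \<le> 63" if "trifferent 10 D" for D
    using that by fastforce
  then have "2 * card D \<le> 3 * 63" if "trifferent 11 D" for D
    using code_size_recursion[of 10 63 D] that by simp
  then have "card D \<le> 94" if "trifferent 11 D" for D
    using that by fastforce
  then have "2 * card C \<le> 3 * 94"
    using code_size_recursion[of 11 94 C] assms by simp
  then show ?thesis
    by simp
qed

theorem theorem2:
  fixes n :: nat
  assumes "n \<ge> 12"
  shows "real (max_trifferent n) \<le> 1.09 * (3 / 2) ^ n"
  using assms
proof (induction n rule: nat_induct_at_least)
  case base
  have "max_trifferent 12 \<le> 141"
    using max_trifferent_attained[of 12] trifferent_12_card by metis
  then have "real (max_trifferent 12) \<le> 141"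
    by simp
  \<comment> \<open>The right-hand side is about 141.42, which explains the constant.\<close>
  also have "\<dots> \<le> 1.09 * (3 / 2) ^ 12"
    by (simp add: power_divide field_simps)
  finally show ?case .
next
  case (Suc n)
  \<comment> \<open>The maximum with 2 meets the hypothesis \<open>2 \<le> M\<close> of the
    recursion; it is harmless because the target bound exceeds 2 from length 12 on.\<close>
  let ?M = "max 2 (max_trifferent n)"
  obtain C where "trifferent (Suc n) C" "card C = max_trifferent (Suc n)"
    using max_trifferent_attained by blast
  moreover have "card D \<le> ?M" if "trifferent n D" for D
    using card_le_max_trifferent[OF that] by simp
  ultimately have "2 * max_trifferent (Suc n) \<le> 3 * ?M"
    using code_size_recursion[of n ?M C] by simp
  then have "real (max_trifferent (Suc n)) \<le> 3 / 2 * real ?M"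
    by linarith
  moreover have "real ?M \<le> 1.09 * (3 / 2) ^ n"
  proof -
    have "(3 / 2 :: real) ^ 12 \<le> (3 / 2) ^ n"
      using Suc.hyps by (intro power_increasing) auto
    then have "2 \<le> 1.09 * (3 / 2 :: real) ^ n"
      by (simp add: power_divide)
    then show ?thesis
      using Suc.IH by simp
  qed
  ultimately show ?case
    by simp
qed

end
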